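(* Let $N \equiv 14 \pmod{16}$. Let $EOEE$ and $OEOE$ denote the numbers of partitions of $N$ into exactly two part sizes lying in the respective parity classes. Then $$EOEE + OEOE \equiv \frac{d(N)}{2} \pmod 4,$$ where $d(N)$ is the number of positive divisors of $N$.
   Context: A partition with exactly two part sizes is written $(\lambda_1^{m_1}\lambda_2^{m_2})$ with $\lambda_1>\lambda_2\ge1$ the part sizes and $m_1,m_2\ge1$ their multiplicities. Its parity class is the word $ABCD$ over $\{O,E\}$ where $A,B,C,D$ record whether $\lambda_1, m_1, \lambda_2, m_2$ respectively are odd ($O$) or even ($E$). *)

theory Defs
  imports "HOL-Library.Multiset" "HOL-Number_Theory.Cong"
begin

(* A partition of N is the multiset of its parts, so the multiplicity of a part size p
   in \<mu> is count \<mu> p. *)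
definition partitions :: "nat \<Rightarrow> nat multiset set" where
  "partitions N = {\<mu>. 0 \<notin># \<mu> \<and> sum_mset \<mu> = N}"

definition two_size_partitions :: "nat \<Rightarrow> nat multiset set" where
  "two_size_partitions N = {\<mu> \<in> partitions N. card (set_mset \<mu>) = 2}"

definition larger_part :: "nat multiset \<Rightarrow> nat" where
  "larger_part \<mu> = Max (set_mset \<mu>)"

definition smaller_part :: "nat multiset \<Rightarrow> nat" where
  "smaller_part \<mu> = Min (set_mset \<mu>)"

(* The letters O and E of the parity words. *)
datatype parity = Od | Ev

definition parity_of :: "nat \<Rightarrow> parity" where
  "parity_of n = (if odd n then Od else Ev)"

definition parity_class :: "nat multiset \<Rightarrow> parity list" where
  "parity_class \<mu> = map parity_of
     [larger_part \<mu>, count \<mu> (larger_part \<mu>), smaller_part \<mu>, count \<mu> (smaller_part \<mu>)]"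

definition class_count :: "parity list \<Rightarrow> nat \<Rightarrow> nat" where
  "class_count w N = card {\<mu> \<in> two_size_partitions N. parity_class \<mu> = w}"

definition EOEE :: "nat \<Rightarrow> nat" where
  "EOEE N = class_count [Ev, Od, Ev, Ev] N"

definition OEOE :: "nat \<Rightarrow> nat" where
  "OEOE N = class_count [Od, Ev, Od, Ev] N"

definition num_divisors :: "nat \<Rightarrow> nat" where
  "num_divisors n = card {d. d dvd n}"

end

theory Submission
  imports Defs "HOL-Library.Disjoint_Sets" "HOL-Library.Z2" "HOL-Number_Theory.Pocklington"
begin

text \<open>Conjugation of partitions interchanges the classes EOEE and OEOE, so it suffices to know the
  parity of OEOE. Put N = 2n. In a partition of class OEOE exactly one of the two halved
  multiplicities is even, so these partitions correspond to the solutions of n = am + 2bc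
  with b odd and a distinct from b. Without the condition that a and b are distinct the number of
  solutions is even, because n = 7 (mod 8) makes swapping a with m, or b with c when a = m, a
  fixed-point-free involution. The solutions with a = b number the sum of (k - 1)/2 over the
  divisors k of n, and the divisor sum of n is a multiple of 4.\<close>

text \<open>In the field \<open>bit\<close> the pair of \<open>x\<close> and \<open>f x\<close>
  contributes \<open>1 + 1 = 0\<close> to the sum of ones. An infinite \<open>S\<close> has
  \<open>card S = 0\<close>, which is even as well.\<close>

lemma even_card_involution:
  assumes "\<And>x. x \<in> S \<Longrightarrow> f x \<in> S" "\<And>x. x \<in> S \<Longrightarrow> f (f x) = x"
    "\<And>x. x \<in> S \<Longrightarrow> f x \<noteq> x"
  shows "even (card S)"
proof -
  have "of_nat (card S) = (\<Sum>x\<in>S. 1 :: bit)" by simp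
  also have "\<dots> = 0" using assms by (intro sum_involution_eq_0[where h = f]) auto
  finally show ?thesis using even_of_nat[where 'a = bit, of "card S"] by simp
qed

section \<open>Partitions with two part sizes as quadruples, and conjugation\<close>

text \<open>The quadruple \<open>(l, m, k, j)\<close> encodes the partition with \<open>m\<close>
  parts \<open>l\<close> and \<open>j\<close> parts \<open>k\<close>, so that bijections between
  classes become arithmetic on four numbers.\<close>

definition two_size_words :: "parity list \<Rightarrow> nat \<Rightarrow> (nat \<times> nat \<times> nat \<times> nat) set" where
  "two_size_words w N = {(l, m, k, j). k < l \<and> 0 < k \<and> 0 < m \<and> 0 < j \<and> l * m + k * j = N \<and>
     map parity_of [l, m, k, j] = w}"

lemma parity_of_eq_iff: "parity_of n = Od \<longleftrightarrow> odd n" "parity_of n = Ev \<longleftrightarrow> even n"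
  by (simp_all add: parity_of_def)

lemma mem_two_size_words:
  "(l, m, k, j) \<in> two_size_words [a, b, c, d] N \<longleftrightarrow>
     k < l \<and> 0 < k \<and> 0 < m \<and> 0 < j \<and> l * m + k * j = N \<and>
     parity_of l = a \<and> parity_of m = b \<and> parity_of k = c \<and> parity_of j = d"
  by (simp add: two_size_words_def)

text \<open>A multiset supported on two elements is determined by these and their counts:
  \<open>g\<close> reads the data off and \<open>f\<close> rebuilds the multiset.\<close>

lemma class_count_eq_card: "class_count w N = card (two_size_words w N)"
proof -
  define f :: "nat \<times> nat \<times> nat \<times> nat \<Rightarrow> nat multiset"
    where "f = (\<lambda>(l, m, k, j). replicate_mset m l + replicate_mset j k)"
  define g :: "nat multiset \<Rightarrow> nat \<times> nat \<times> nat \<times> nat"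
    where "g = (\<lambda>\<mu>. (larger_part \<mu>, count \<mu> (larger_part \<mu>),
                 smaller_part \<mu>, count \<mu> (smaller_part \<mu>)))"
  define P where "P = {\<mu> \<in> two_size_partitions N. parity_class \<mu> = w}"
  have gf: "g (f (l, m, k, j)) = (l, m, k, j)"
    and set_f: "set_mset (f (l, m, k, j)) = {k, l}"
    and parts_f: "larger_part (f (l, m, k, j)) = l" "smaller_part (f (l, m, k, j)) = k"
    and counts_f: "count (f (l, m, k, j)) l = m" "count (f (l, m, k, j)) k = j"
    if "k < l" "0 < m" "0 < j" for l m k j
  proof -
    show *: "set_mset (f (l, m, k, j)) = {k, l}"
      using that by (auto simp: f_def)
    show parts: "larger_part (f (l, m, k, j)) = l" "smaller_part (f (l, m, k, j)) = k"
      unfolding larger_part_def smaller_part_def * using that by auto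
    show counts: "count (f (l, m, k, j)) l = m" "count (f (l, m, k, j)) k = j"
      using that by (simp_all add: f_def)
    show "g (f (l, m, k, j)) = (l, m, k, j)" by (simp add: g_def parts counts)
  qed
  have fP: "f x \<in> P" "g (f x) = x" if "x \<in> two_size_words w N" for x
  proof -
    obtain l m k j where x: "x = (l, m, k, j)" by (cases x)
    have h: "k < l" "0 < k" "0 < m" "0 < j" "l * m + k * j = N"
      "map parity_of [l, m, k, j] = w"
      using that unfolding x two_size_words_def by auto
    show "g (f x) = x" using gf h x by simp
    have s: "set_mset (f x) = {k, l}" using set_f h x by simp
    have "sum_mset (f x) = N" using h x by (simp add: f_def mult.commute)
    moreover have "parity_class (f x) = w"
      using h by (simp add: x parity_class_def parts_f counts_f)
    ultimately show "f x \<in> P"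
      using s h by (simp add: P_def two_size_partitions_def partitions_def)
  qed
  have gP: "g \<mu> \<in> two_size_words w N" "f (g \<mu>) = \<mu>" if "\<mu> \<in> P" for \<mu>
  proof -
    have h: "0 \<notin># \<mu>" "sum_mset \<mu> = N" "card (set_mset \<mu>) = 2" "parity_class \<mu> = w"
      using that by (auto simp: P_def two_size_partitions_def partitions_def)
    obtain u v where uv: "set_mset \<mu> = {u, v}" "u \<noteq> v"
      using h(3) by (auto simp: card_2_iff)
    define k l where "k = min u v" and "l = max u v"
    have kl: "set_mset \<mu> = {k, l}" "k < l"
      using uv by (auto simp: k_def l_def min_def max_def)
    have parts: "larger_part \<mu> = l" "smaller_part \<mu> = k"
      using kl by (auto simp: larger_part_def smaller_part_def)
    have pos: "0 < count \<mu> k" "0 < count \<mu> l" "0 < k"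
      using kl h(1) by (auto intro!: Nat.gr0I simp: count_eq_zero_iff)
    have g: "g \<mu> = (l, count \<mu> l, k, count \<mu> k)" by (simp add: g_def parts)
    show fg: "f (g \<mu>) = \<mu>"
    proof (rule multiset_eqI)
      fix x
      show "count (f (g \<mu>)) x = count \<mu> x"
      proof (cases "x \<in> {k, l}")
        case True
        then show ?thesis using kl(2) by (auto simp: g f_def)
      next
        case False
        then have "count \<mu> x = 0" using kl(1) by (metis count_eq_zero_iff)
        then show ?thesis using False by (simp add: g f_def)
      qed
    qed
    have "sum_mset (f (g \<mu>)) = l * count \<mu> l + k * count \<mu> k"
      by (simp add: g f_def mult.commute)
    then show "g \<mu> \<in> two_size_words w N"
      using h kl pos fg by (simp add: two_size_words_def g parity_class_def parts)
  qed
  have "bij_betw g P (two_size_words w N)"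
    by (rule bij_betw_byWitness[where f' = f]) (use fP gP in auto)
  then show ?thesis
    unfolding class_count_def P_def by (rule bij_betw_same_card)
qed

lemma EOEE_eq_OEOE: "EOEE N = OEOE N"
proof -
  \<comment> \<open>In the Ferrers diagram the first \<open>k\<close> columns have height
    \<open>m + j\<close> and the other \<open>l - k\<close> have height \<open>m\<close>.
    Conjugation is its own inverse, so one map serves for both directions.\<close>
  let ?conj = "\<lambda>(l, m, k, j). (m + j, k, m, l - k) :: nat \<times> nat \<times> nat \<times> nat"
  have eq: "(m + j) * k + m * (l - k) = l * m + k * j" if "k < l" for l m k j :: nat
  proof -
    obtain r where "l = k + r" using \<open>k < l\<close> le_Suc_ex[of k l] by auto
    then show ?thesis by (simp add: algebra_simps)
  qed
  have "bij_betw ?conj (two_size_words [Ev, Od, Ev, Ev] N) (two_size_words [Od, Ev, Od, Ev] N)"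
  proof (rule bij_betw_byWitness[where f' = ?conj])
    have conj: "?conj x \<in> two_size_words [Od, Ev, Od, Ev] N"
      if "x \<in> two_size_words [Ev, Od, Ev, Ev] N" for x
    proof -
      obtain l m k j where x: "x = (l, m, k, j)" by (cases x)
      show ?thesis
        using that eq[of k l m j] unfolding x by (simp add: mem_two_size_words parity_of_eq_iff)
    qed
    have conj': "?conj x \<in> two_size_words [Ev, Od, Ev, Ev] N"
      if "x \<in> two_size_words [Od, Ev, Od, Ev] N" for x
    proof -
      obtain l m k j where x: "x = (l, m, k, j)" by (cases x)
      show ?thesis
        using that eq[of k l m j] unfolding x by (simp add: mem_two_size_words parity_of_eq_iff)
    qed
    show "?conj ` two_size_words [Ev, Od, Ev, Ev] N \<subseteq> two_size_words [Od, Ev, Od, Ev] N"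
      using conj by blast
    show "?conj ` two_size_words [Od, Ev, Od, Ev] N \<subseteq> two_size_words [Ev, Od, Ev, Ev] N"
      using conj' by blast
  qed (simp_all add: two_size_words_def split: prod.splits)
  then show ?thesis
    unfolding EOEE_def OEOE_def class_count_eq_card by (rule bij_betw_same_card)
qed

section \<open>The equation \<open>a * m + 2 * b * c = n\<close> and its link to OEOE\<close>

text \<open>Doubling the equation gives a partition of \<open>2 * n\<close> with
  \<open>2 * m\<close> parts \<open>a\<close> and \<open>4 * c\<close> parts \<open>b\<close>,
  provided \<open>a \<noteq> b\<close>. For odd \<open>n\<close> the equation itself makes
  \<open>a\<close> and \<open>m\<close> odd; the oddness of \<open>b\<close> has to be
  imposed.\<close>

definition odd_solutions :: "nat \<Rightarrow> (nat \<times> nat \<times> nat \<times> nat) set" where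
  "odd_solutions n =
     {(a, m, b, c). 0 < a \<and> 0 < m \<and> 0 < b \<and> 0 < c \<and> a * m + 2 * b * c = n \<and> odd b}"

lemma finite_odd_solutions: "finite (odd_solutions n)"
proof (rule finite_subset)
  have le: "x \<le> x * y" "y \<le> x * y" if "0 < x" "0 < y" for x y :: nat
    using that by auto
  show "odd_solutions n \<subseteq> {..n} \<times> {..n} \<times> {..n} \<times> {..n}"
  proof
    fix q assume "q \<in> odd_solutions n"
    then obtain a m b c where "q = (a, m, b, c)" "0 < a" "0 < m" "0 < b" "0 < c"
      "a * m + 2 * (b * c) = n"
      by (auto simp: odd_solutions_def mult.assoc)
    then show "q \<in> {..n} \<times> {..n} \<times> {..n} \<times> {..n}"
      using le[of a m] le[of b c] by (simp, intro conjI; linarith)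
  qed
qed simp

lemma even_card_odd_solutions:
  assumes "n mod 8 = 7"
  shows "even (card (odd_solutions n))"
proof (rule even_card_involution)
  let ?f = "\<lambda>(a, m, b, c). if a \<noteq> m then (m, a, b, c) else (a, m, c, b) :: nat \<times> nat \<times> nat \<times> nat"
  have square: "b * b mod 8 = 1" if "odd b" for b :: nat
    using that square_mod_8_eq_1_iff[of b] by (simp add: cong_def power2_eq_square)
  \<comment> \<open>Here \<open>2 * t\<close> is 6 modulo 8; the four residues of \<open>t\<close>
    modulo 4 are tried in turn.\<close>
  have mod_4: "t mod 4 = 3" if "s mod 8 = 1" "s + 2 * t = n" for s t
  proof -
    have "(1 + 2 * (t mod 4)) mod 8 = 7"
      using that assms mod_add_eq[of s 8 "2 * t"] by (simp add: mult_mod_right)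
    moreover have "t mod 4 \<in> {..<4}" by simp
    ultimately show ?thesis by (auto simp: lessThan_nat_numeral)
  qed
  \<comment> \<open>When \<open>a = m\<close>, the product \<open>b * c\<close> is 3 modulo 4. Hence
    \<open>c\<close> is odd, so exchanging \<open>b\<close> and \<open>c\<close> stays inside the
    set, and \<open>b \<noteq> c\<close> because an odd square is 1 modulo 4, so the exchange moves
    the point.\<close>
  have key: "odd c \<and> b \<noteq> c" if eq: "a * a + 2 * b * c = n" for a b c
  proof -
    have "odd n" using assms by presburger
    then have "odd a" unfolding eq[symmetric] by simp
    then have "a * a mod 8 = 1" by (rule square)
    moreover have "a * a + 2 * (b * c) = n" using eq by (simp add: mult.assoc)
    ultimately have bc: "b * c mod 4 = 3" using mod_4 by blast
    then have "odd (b * c)" by presburger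
    moreover have "b * b mod 4 = 1" if "odd b" using square[OF that] by presburger
    ultimately show ?thesis using bc by auto
  qed
  fix x assume "x \<in> odd_solutions n"
  then obtain a m b c where x: "x = (a, m, b, c)"
    and pos: "0 < a" "0 < m" "0 < b" "0 < c" "odd b" and eq: "a * m + 2 * b * c = n"
    by (auto simp: odd_solutions_def)
  show "?f x \<in> odd_solutions n"
  proof (cases "a = m")
    case True
    then show ?thesis using key[of a b c] eq pos
      by (simp add: x odd_solutions_def mult.commute mult.left_commute)
  next
    case False
    then show ?thesis using eq pos by (simp add: x odd_solutions_def mult.commute[of m a])
  qed
  show "?f (?f x) = x" by (simp add: x)
  show "?f x \<noteq> x" using key[of a b c] eq by (auto simp: x)
qed

text \<open>Of the two even multiplicities exactly one is divisible by 4. Its part is called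
  \<open>b\<close> and the other one \<open>a\<close>, whichever of them is larger.\<close>

lemma OEOE_eq_card:
  assumes "odd n"
  shows "OEOE (2 * n) = card {(a, m, b, c) \<in> odd_solutions n. a \<noteq> b}"
proof -
  let ?f = "\<lambda>(a, m, b, c). if b < a then (a, 2 * m, b, 4 * c) else (b, 4 * c, a, 2 * m)
    :: nat \<times> nat \<times> nat \<times> nat"
  \<comment> \<open>The test \<open>4 dvd j\<close> decides whether the smaller part plays the role
    of \<open>b\<close>; it undoes the sorting by size in \<open>?f\<close> because
    \<open>2 * m\<close> with \<open>m\<close> odd is not divisible by 4.\<close>
  let ?g = "\<lambda>(l, m, k, j). if 4 dvd j then (l, m div 2, k, j div 4) else (k, j div 2, l, m div 4)
    :: nat \<times> nat \<times> nat \<times> nat"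
  have odd_am: "odd a" "odd m" if "a * m + 2 * b * c = n" for a m b c
  proof -
    have "odd (a * m)" using assms unfolding that[symmetric] by simp
    then show "odd a" "odd m" by auto
  qed
  \<comment> \<open>Halving both multiplicities gives \<open>l * x + k * y = n\<close> with
    \<open>l\<close>, \<open>k\<close> and \<open>n\<close> odd, so exactly one of \<open>x\<close>
    and \<open>y\<close> is even.\<close>
  have cases: "(\<exists>x y. m = 2 * x \<and> odd x \<and> j = 4 * y) \<or> (\<exists>x y. m = 4 * x \<and> j = 2 * y \<and> odd y)"
    if "l * m + k * j = 2 * n" "odd l" "odd k" and m: "even m" and j: "even j" for l m k j
  proof -
    obtain x y where xy: "m = 2 * x" "j = 2 * y" using m j by (metis evenE)
    then have "l * x + k * y = n" using that by simp
    then have "even x \<noteq> even y" using that assms by (metis even_add even_mult_iff)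
    then show ?thesis using xy by (auto elim!: evenE)
  qed
  have "bij_betw ?f {(a, m, b, c) \<in> odd_solutions n. a \<noteq> b} (two_size_words [Od, Ev, Od, Ev] (2 * n))"
  proof (rule bij_betw_byWitness[where f' = ?g])
    have *: "?g (?f x) = x \<and> ?f x \<in> two_size_words [Od, Ev, Od, Ev] (2 * n)"
      if "x \<in> {(a, m, b, c) \<in> odd_solutions n. a \<noteq> b}" for x
    proof -
      obtain a m b c where x: "x = (a, m, b, c)" by (cases x)
      have pos: "a \<noteq> b" "0 < a" "0 < m" "0 < b" "0 < c" "odd b" and eq: "a * m + 2 * b * c = n"
        using that by (simp_all add: x odd_solutions_def)
      have "\<not> 4 dvd 2 * m" using odd_am[OF eq] by presburger
      moreover have "2 * (a * m) + 4 * (b * c) = 2 * n" using eq by (simp add: algebra_simps)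
      ultimately show ?thesis
        using x pos odd_am[OF eq] by (simp add: mem_two_size_words parity_of_eq_iff algebra_simps)
    qed
    have **: "?f (?g x) = x \<and> ?g x \<in> {(a, m, b, c) \<in> odd_solutions n. a \<noteq> b}"
      if "x \<in> two_size_words [Od, Ev, Od, Ev] (2 * n)" for x
    proof -
      obtain l m k j where x: "x = (l, m, k, j)" by (cases x)
      have h: "k < l" "0 < k" "0 < m" "0 < j" "l * m + k * j = 2 * n"
        "odd l" "even m" "odd k" "even j"
        using that by (simp_all add: x mem_two_size_words parity_of_eq_iff)
      from cases[OF h(5,6,8,7,9)] consider
        (1) u v where "m = 2 * u" "odd u" "j = 4 * v" | (2) u v where "m = 4 * u" "j = 2 * v" "odd v"
        by blast
      then show ?thesis
      proof cases
        case 1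
        then show ?thesis using h by (simp add: x odd_solutions_def algebra_simps)
      next
        case 2
        then have "\<not> 4 dvd j" by presburger
        then show ?thesis using 2 h by (simp add: x odd_solutions_def algebra_simps)
      qed
    qed
    show "\<forall>x\<in>{(a, m, b, c) \<in> odd_solutions n. a \<noteq> b}. ?g (?f x) = x"
      by (intro ballI conjunct1[OF *])
    show "?f ` {(a, m, b, c) \<in> odd_solutions n. a \<noteq> b} \<subseteq> two_size_words [Od, Ev, Od, Ev] (2 * n)"
      by (intro image_subsetI conjunct2[OF *])
    show "\<forall>x\<in>two_size_words [Od, Ev, Od, Ev] (2 * n). ?f (?g x) = x"
      by (intro ballI conjunct1[OF **])
    show "?g ` two_size_words [Od, Ev, Od, Ev] (2 * n) \<subseteq> {(a, m, b, c) \<in> odd_solutions n. a \<noteq> b}"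
      by (intro image_subsetI conjunct2[OF **])
  qed
  then show ?thesis
    unfolding OEOE_def class_count_eq_card by (rule bij_betw_same_card[symmetric])
qed

section \<open>Solutions with equal parts, and divisor sums\<close>

text \<open>If \<open>a = b\<close>, the equation factors as \<open>b * (m + 2 * c) = n\<close>. A
  divisor \<open>k = m + 2 * c\<close> fixes \<open>b\<close>, and then \<open>c\<close> is free
  subject to \<open>0 < 2 * c < k\<close>.\<close>

lemma card_diagonal_solutions:
  assumes "odd n"
  shows "card {(a, m, b, c) \<in> odd_solutions n. a = b} = (\<Sum>k | k dvd n. k div 2)"
proof -
  let ?S = "SIGMA k:{k. k dvd n}. {1..k div 2}"
  let ?f = "\<lambda>(k, c). (n div k, k - 2 * c, n div k, c)"
  let ?g = "\<lambda>(a, m, b, c). (m + 2 * c, c) :: nat \<times> nat"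
  have n: "0 < n" using assms by (auto intro!: Nat.gr0I)
  have odd_dvd: "odd k" if "k dvd n" for k using that assms dvd_trans by blast
  have "bij_betw ?f ?S {(a, m, b, c) \<in> odd_solutions n. a = b}"
  proof (rule bij_betw_byWitness[where f' = ?g])
    show "\<forall>x\<in>?S. ?g (?f x) = x" by auto
    show "\<forall>x\<in>{(a, m, b, c) \<in> odd_solutions n. a = b}. ?f (?g x) = x"
    proof clarsimp
      fix m b c assume "(b, m, b, c) \<in> odd_solutions n"
      then have "n = b * (m + 2 * c)" "0 < m" by (auto simp: odd_solutions_def algebra_simps)
      then show "n div (m + 2 * c) = b" by simp
    qed
    show "?g ` {(a, m, b, c) \<in> odd_solutions n. a = b} \<subseteq> ?S"
    proof
      fix y assume "y \<in> ?g ` {(a, m, b, c) \<in> odd_solutions n. a = b}"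
      then obtain b m c where "y = (m + 2 * c, c)" "(b, m, b, c) \<in> odd_solutions n" by auto
      moreover from this have "n = b * (m + 2 * c)" "0 < c"
        by (auto simp: odd_solutions_def algebra_simps)
      ultimately show "y \<in> ?S" by auto
    qed
    show "?f ` ?S \<subseteq> {(a, m, b, c) \<in> odd_solutions n. a = b}"
    proof clarsimp
      fix k c assume k: "k dvd n" and c: "Suc 0 \<le> c" "c \<le> k div 2"
      \<comment> \<open>Oddness of \<open>k\<close> makes the inequality strict, so that
        \<open>m = k - 2 * c\<close> is positive.\<close>
      have lt: "2 * c < k" using c odd_dvd[OF k] by presburger
      have "n div k * (k - 2 * c) + 2 * (n div k) * c = n div k * (k - 2 * c + 2 * c)"
        by (simp add: algebra_simps)
      also have "\<dots> = n" using k lt by simp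
      finally have "n div k * (k - 2 * c) + 2 * (n div k) * c = n" .
      moreover have "n div k dvd n" using k by (metis dvd_mult_div_cancel dvd_triv_right)
      moreover have "0 < n div k" using k n by (metis dvd_mult_div_cancel mult_0_right not_gr_zero)
      ultimately show "(n div k, k - 2 * c, n div k, c) \<in> odd_solutions n"
        using lt c odd_dvd by (auto simp: odd_solutions_def)
    qed
  qed
  then have "card {(a, m, b, c) \<in> odd_solutions n. a = b} = card ?S"
    by (rule bij_betw_same_card[symmetric])
  also have "\<dots> = (\<Sum>k | k dvd n. k div 2)" using n by (simp add: card_SigmaI)
  finally show ?thesis .
qed

text \<open>Pair \<open>k\<close> with \<open>n div k\<close>. Their product is -1 modulo 8 and
  every unit modulo 8 is its own inverse, so their sum is 0 modulo 8. Summing over all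
  \<open>k\<close> counts each divisor twice, which leaves a factor 4.\<close>

lemma four_dvd_divisor_sum:
  assumes "n mod 8 = 7"
  shows "4 dvd (\<Sum>k | k dvd n. k :: nat)"
proof -
  have n: "0 < n" using assms by (auto intro!: Nat.gr0I)
  have "(\<Sum>k | k dvd n. k) = (\<Sum>k | k dvd n. n div k)"
    by (rule sum.reindex_bij_witness[where i = "\<lambda>k. n div k" and j = "\<lambda>k. n div k"])
       (use n in \<open>auto simp: div_dvd_iff_mult dvd_div_iff_mult\<close>)
  then have "2 * (\<Sum>k | k dvd n. k) = (\<Sum>k | k dvd n. k + n div k)"
    by (simp add: sum.distrib)
  also have "8 dvd \<dots>"
  proof (rule dvd_sum)
    fix k assume "k \<in> {k. k dvd n}"
    then have prod: "k * (n div k) mod 8 = 7" using assms by simp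
    \<comment> \<open>The claim about units modulo 8 is checked on all pairs of residues.\<close>
    have "k mod 8 \<in> {..<8}" "n div k mod 8 \<in> {..<8}" by auto
    then have "(k mod 8 + n div k mod 8) mod 8 = 0"
      using prod unfolding mod_mult_eq[of k 8 "n div k", symmetric]
      by (auto simp: lessThan_nat_numeral)
    then show "8 dvd k + n div k" by (simp add: mod_add_eq dvd_eq_mod_eq_0)
  qed
  finally show ?thesis by presburger
qed

text \<open>The odd divisors of \<open>2 * n\<close> are the divisors of \<open>n\<close>, and the
  even ones are their doubles.\<close>

lemma num_divisors_twice_odd:
  assumes "odd n"
  shows "num_divisors (2 * n) = 2 * num_divisors n"
proof -
  have n: "0 < n" using assms by (auto intro!: Nat.gr0I)
  have "{d. d dvd 2 * n} = {d. d dvd n} \<union> (*) 2 ` {d. d dvd n}"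
  proof (intro equalityI subsetI)
    fix d assume d: "d \<in> {d. d dvd 2 * n}"
    show "d \<in> {d. d dvd n} \<union> (*) 2 ` {d. d dvd n}"
    proof (cases "even d")
      case True
      then show ?thesis using d by (auto elim!: evenE)
    next
      case False
      then have "coprime d 2" by simp
      then show ?thesis using d by (simp add: coprime_dvd_mult_right_iff)
    qed
  qed auto
  moreover have "{d. d dvd n} \<inter> (*) 2 ` {d. d dvd n} = {}"
    using assms dvd_mult_left by blast
  ultimately show ?thesis
    using n by (simp add: num_divisors_def card_Un_disjoint card_image inj_on_def)
qed

section \<open>Combining the parity of OEOE with the divisor sum modulo 4\<close>

theorem theorem4p2:
  fixes N :: nat
  assumes "[N = 14] (mod 16)"
  shows "[EOEE N + OEOE N = num_divisors N div 2] (mod 4)"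
proof -
  have "N mod 16 = 14" using assms by (simp add: cong_def)
  then obtain q where q: "N = 16 * q + 14" using mult_div_mod_eq[of 16 N] by metis
  define n where "n = 8 * q + 7"
  have N: "N = 2 * n" and n: "n mod 8 = 7" "odd n" by (simp_all add: q n_def)
  \<comment> \<open>\<open>A\<close> counts the solutions with \<open>a = b\<close>. All divisors
    \<open>k\<close> of \<open>n\<close> are odd, so \<open>k = 2 * (k div 2) + 1\<close>, and
    summing expresses the divisor sum as \<open>2 * A + num_divisors n\<close>.\<close>
  define A where "A = (\<Sum>k | k dvd n. k div 2)"
  have "(\<Sum>k | k dvd n. k) = (\<Sum>k | k dvd n. 2 * (k div 2) + 1)"
    using n(2) dvd_trans by (intro sum.cong) (auto intro!: odd_two_times_div_two_succ[symmetric])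
  also have "\<dots> = 2 * A + num_divisors n"
    unfolding A_def num_divisors_def by (simp only: sum.distrib sum_distrib_left card_eq_sum)
  finally have sigma: "4 dvd 2 * A + num_divisors n"
    using four_dvd_divisor_sum[OF n(1)] by simp
  have "odd_solutions n =
      {(a, m, b, c) \<in> odd_solutions n. a \<noteq> b} \<union> {(a, m, b, c) \<in> odd_solutions n. a = b}"
    by auto
  also have "card \<dots> = OEOE N + A"
    unfolding N A_def OEOE_eq_card[OF n(2)] card_diagonal_solutions[OF n(2), symmetric]
    by (rule card_Un_disjoint) (auto intro: finite_subset[OF _ finite_odd_solutions])
  finally have "even (OEOE N + A)"
    using even_card_odd_solutions[OF n(1)] by simp
  then obtain t where t: "OEOE N + A = 2 * t" by blast
  obtain r where r: "2 * A + num_divisors n = 4 * r" using sigma by blast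
  \<comment> \<open>Modulo 4, \<open>2 * OEOE N\<close> agrees with \<open>- 2 * A\<close> by
    parity, and this agrees with \<open>num_divisors n\<close> by the divisor sum. The multiples of
    4 stand on the sides where no subtraction of naturals occurs.\<close>
  have "2 * OEOE N + 4 * r = num_divisors n + 4 * t" using t r by linarith
  then have "(2 * OEOE N + 4 * r) mod 4 = (num_divisors n + 4 * t) mod 4" by (rule arg_cong)
  then show ?thesis
    by (simp add: cong_def EOEE_eq_OEOE mult_2[symmetric] N num_divisors_twice_odd[OF n(2)])
qed

end
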